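(* For a semiprime evolution algebra $A$ over a field $K$, the following are equivalent: (i) $A$ is prime. (ii) Any graph $E$ associated to $A$ (relative to any natural basis of $A$) is downward directed.
   Context: Algebras are not assumed associative. An evolution algebra over $K$ is a $K$-algebra $A$ having a basis $B=\{e_i\}_{i\in\Lambda}$ (a natural basis) with $e_ie_j=0$ for all $i\ne j$. Write $e_i^2=\sum_{j\in\Lambda}\omega_{ji}e_j$. The directed graph $E$ associated to $A$ relative to $B$ has vertex set $E^0=\{e_i\}_{i\in\Lambda}$ and exactly one edge from $e_i$ to $e_j$ if $\omega_{ji}\neq 0$, and none otherwise. $A$ is semiprime if any ideal $I$ of $A$ with $I^2=0$ is $0$. $A$ is prime if for any ideals $I,J$ of $A$ with $IJ=0$ one has $I=0$ or $J=0$. For vertices $u,v$ write $u\ge v$ if there is a directed path from $u$ to $v$ (paths of length $0$ allowed). $E$ is downward directed if for every $u,v\in E^0$ there exists $z\in E^0$ with $u\ge z$ and $v\ge z$. *)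

theory Defs
  imports Main "Graph_Theory.Pair_Digraph"
begin

text \<open>The underlying vector space of an algebra is a whole type, of arbitrary dimension (possibly
  zero or infinite). No associativity, commutativity or unit is assumed.\<close>

locale nonassoc_algebra = vector_space scale
  for scale :: "'k::field \<Rightarrow> 'a::ab_group_add \<Rightarrow> 'a" (infixr \<open>*s\<close> 75) +
  fixes mul :: "'a \<Rightarrow> 'a \<Rightarrow> 'a" (infixl \<open>\<cdot>\<close> 70)
  assumes mul_add_left: "(x + y) \<cdot> z = x \<cdot> z + y \<cdot> z"
    and mul_add_right: "x \<cdot> (y + z) = x \<cdot> y + x \<cdot> z"
    and mul_scale_left: "(c *s x) \<cdot> y = c *s (x \<cdot> y)"
    and mul_scale_right: "x \<cdot> (c *s y) = c *s (x \<cdot> y)"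
begin

definition algebra_ideal :: "'a set \<Rightarrow> bool" where
  "algebra_ideal I \<longleftrightarrow> subspace I \<and> (\<forall>a. \<forall>x\<in>I. a \<cdot> x \<in> I \<and> x \<cdot> a \<in> I)"

text \<open>As usual, \<open>I J\<close> is the linear span of all products \<open>x \<cdot> y\<close>, not merely their set.\<close>

definition ideal_mult :: "'a set \<Rightarrow> 'a set \<Rightarrow> 'a set" where
  "ideal_mult I J = span {x \<cdot> y | x y. x \<in> I \<and> y \<in> J}"

definition semiprime_algebra :: bool where
  "semiprime_algebra \<longleftrightarrow> (\<forall>I. algebra_ideal I \<longrightarrow> ideal_mult I I = {0} \<longrightarrow> I = {0})"

text \<open>The zero algebra counts as prime; correspondingly, the empty graph is downward directed.\<close>

definition prime_algebra :: bool where
  "prime_algebra \<longleftrightarrow>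
     (\<forall>I J. algebra_ideal I \<longrightarrow> algebra_ideal J \<longrightarrow> ideal_mult I J = {0} \<longrightarrow> I = {0} \<or> J = {0})"

definition natural_basis :: "'a set \<Rightarrow> bool" where
  "natural_basis B \<longleftrightarrow>
     independent B \<and> span B = UNIV \<and> (\<forall>u\<in>B. \<forall>v\<in>B. u \<noteq> v \<longrightarrow> u \<cdot> v = 0)"

text \<open>For \<open>u = e\<^sub>i\<close> and \<open>v = e\<^sub>j\<close> in \<open>B\<close>, the coordinate \<open>representation B (u \<cdot> u) v\<close> is the
  structure constant \<open>\<omega>\<^sub>j\<^sub>i\<close>, the coefficient of \<open>e\<^sub>j\<close> in the square of \<open>e\<^sub>i\<close>.\<close>

definition associated_graph :: "'a set \<Rightarrow> 'a pair_pre_digraph" where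
  "associated_graph B =
     \<lparr> pverts = B,
       parcs = {(u, v). u \<in> B \<and> v \<in> B \<and> representation B (u \<cdot> u) v \<noteq> 0} \<rparr>"

end

locale evolution_algebra = nonassoc_algebra +
  assumes ex_natural_basis: "\<exists>B. natural_basis B"

definition downward_directed :: "('a, 'b) pre_digraph \<Rightarrow> bool" where
  "downward_directed G \<longleftrightarrow>
     (\<forall>u\<in>verts G. \<forall>v\<in>verts G. \<exists>z\<in>verts G. u \<rightarrow>\<^sup>*\<^bsub>G\<^esub> z \<and> v \<rightarrow>\<^sup>*\<^bsub>G\<^esub> z)"

end

theory Submission
  imports Defs
begin

text \<open>Fix a natural basis \<open>B\<close> and its graph. The square of a vertex is a combination of the heads of
  its arcs, and multiplying an arbitrary element by a vertex \<open>e\<close>, on either side, only produces a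
  multiple of \<open>e \<cdot> e\<close>. Ideals therefore interact with the graph in two ways.

  A set of vertices closed under arcs spans an ideal (\<open>algebra_ideal_span\<close>). In particular the
  descendants of a vertex span a nonzero ideal. If \<open>u\<close> and \<open>v\<close> had no common descendant, the two
  ideals obtained in this way would be spanned by disjoint sets of basis vectors, so that their
  product would vanish. A prime algebra thus has only downward directed graphs
  (\<open>prime_imp_downward_directed\<close>).

  Conversely, a nonzero element of an ideal \<open>I\<close> has a nonzero coordinate at some vertex \<open>e\<close>;
  multiplying by \<open>e\<close> puts \<open>e \<cdot> e\<close> into \<open>I\<close>, and the same argument, applied to \<open>e \<cdot> e\<close>, transports
  this membership along arcs, so that \<open>I\<close> contains the squares of all descendants of \<open>e\<close>
  (\<open>square_descendant_in_ideal\<close>). Over a downward directed graph, two nonzero ideals \<open>I\<close> and \<open>J\<close>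
  hence contain the square of a common vertex \<open>z\<close>, which is nonzero in a semiprime algebra
  (\<open>semiprime_square_nonzero\<close>). Now \<open>I \<inter> J\<close> is a nonzero ideal whose square lies in \<open>I J\<close>; if
  \<open>I J\<close> were zero, this would contradict semiprimeness. One natural basis with a downward directed
  graph is enough here (\<open>semiprime_downward_directed_imp_prime\<close>), and an evolution algebra has at
  least one natural basis.\<close>

context nonassoc_algebra
begin

lemma mul_zero_left [simp]: "0 \<cdot> x = 0"
  using mul_add_left[of 0 0 x] by simp

lemma mul_zero_right [simp]: "x \<cdot> 0 = 0"
  using mul_add_right[of x 0 0] by simp

lemma ideal_mult_eq_0_iff:
  assumes "algebra_ideal I" and "algebra_ideal J"
  shows "ideal_mult I J = {0} \<longleftrightarrow> (\<forall>x\<in>I. \<forall>y\<in>J. x \<cdot> y = 0)"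
proof
  assume "ideal_mult I J = {0}"
  then show "\<forall>x\<in>I. \<forall>y\<in>J. x \<cdot> y = 0"
    using span_superset[of "{x \<cdot> y | x y. x \<in> I \<and> y \<in> J}"] unfolding ideal_mult_def by auto
next
  assume "\<forall>x\<in>I. \<forall>y\<in>J. x \<cdot> y = 0"
  moreover have "0 \<in> I" "0 \<in> J"
    using assms by (auto simp: algebra_ideal_def subspace_0)
  ultimately have "{x \<cdot> y | x y. x \<in> I \<and> y \<in> J} = {0}"
    by (auto intro!: exI[of _ 0])
  then show "ideal_mult I J = {0}"
    by (simp add: ideal_mult_def)
qed

lemma mul_span_eq_0:
  assumes prod: "\<And>s t. s \<in> S \<Longrightarrow> t \<in> T \<Longrightarrow> s \<cdot> t = 0"
    and "x \<in> span S" and "y \<in> span T"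
  shows "x \<cdot> y = 0"
proof -
  have "s \<cdot> y = 0" if "s \<in> S" for s
    using \<open>y \<in> span T\<close>
    by (induction rule: span_induct_alt) (auto simp: mul_add_right mul_scale_right prod that)
  with \<open>x \<in> span S\<close> show ?thesis
    by (induction rule: span_induct_alt) (auto simp: mul_add_left mul_scale_left)
qed

lemma algebra_ideal_Int:
  "algebra_ideal I \<Longrightarrow> algebra_ideal J \<Longrightarrow> algebra_ideal (I \<inter> J)"
  by (auto simp: algebra_ideal_def subspace_inter)

text \<open>Only the \<open>e\<close>-coordinate of a factor survives multiplication by the basis vector \<open>e\<close>, since
  the other basis vectors annihilate \<open>e\<close>.\<close>

lemma mul_natural_basis_vector:
  assumes B: "natural_basis B" and e: "e \<in> B"
  shows "x \<cdot> e = representation B x e *s (e \<cdot> e)"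
    and "e \<cdot> x = representation B x e *s (e \<cdot> e)"
proof -
  have ind: "independent B" and UNIV: "\<And>z. z \<in> span B"
    and orth: "\<And>u v. u \<in> B \<Longrightarrow> v \<in> B \<Longrightarrow> u \<noteq> v \<Longrightarrow> u \<cdot> v = 0"
    using B by (auto simp: natural_basis_def)
  have "x \<cdot> e = representation B x e *s (e \<cdot> e) \<and> e \<cdot> x = representation B x e *s (e \<cdot> e)"
    using UNIV[of x]
  proof (induction rule: span_induct_alt)
    case base
    then show ?case by (simp add: representation_zero)
  next
    case (step c b y)
    have "representation B (c *s b + y) e = c * (if e = b then 1 else 0) + representation B y e"
      using ind UNIV step(1)
      by (simp add: representation_add representation_scale representation_basis)
    with step orth[of b e] orth[of e b] e show ?case
      by (auto simp: mul_add_left mul_add_right mul_scale_left mul_scale_right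
          scale_left_distrib)
  qed
  then show "x \<cdot> e = representation B x e *s (e \<cdot> e)"
    and "e \<cdot> x = representation B x e *s (e \<cdot> e)"
    by auto
qed

lemma algebra_ideal_span:
  assumes B: "natural_basis B" and HB: "H \<subseteq> B"
    and closed: "\<And>u v. u \<in> H \<Longrightarrow> (u, v) \<in> parcs (associated_graph B) \<Longrightarrow> v \<in> H"
  shows "algebra_ideal (span H)"
proof -
  have square: "h \<cdot> h \<in> span H" if h: "h \<in> H" for h
  proof -
    have "h \<cdot> h = (\<Sum>v | representation B (h \<cdot> h) v \<noteq> 0. representation B (h \<cdot> h) v *s v)"
      using B by (simp add: natural_basis_def sum_nonzero_representation_eq)
    also have "\<dots> \<in> span H"
    proof (intro span_sum span_scale span_base)
      fix v assume "v \<in> {v. representation B (h \<cdot> h) v \<noteq> 0}"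
      then have "(h, v) \<in> parcs (associated_graph B)"
        using h HB representation_ne_zero by (auto simp: associated_graph_def)
      with h show "v \<in> H" by (rule closed)
    qed
    finally show ?thesis .
  qed
  have "a \<cdot> x \<in> span H \<and> x \<cdot> a \<in> span H" if "x \<in> span H" for a x
    using that
  proof (induction rule: span_induct_alt)
    case base
    then show ?case by (simp add: span_zero)
  next
    case (step c h y)
    have "a \<cdot> h \<in> span H" "h \<cdot> a \<in> span H"
      using mul_natural_basis_vector[OF B, of h a] square[of h] step(1) HB
      by (auto simp: span_scale)
    with step show ?case
      by (auto simp: mul_add_left mul_add_right mul_scale_left mul_scale_right
          intro!: span_add span_scale)
  qed
  then show ?thesis
    by (simp add: algebra_ideal_def subspace_span)
qed

text \<open>A vertex with zero square has no outgoing arcs, so its line would be an ideal, of square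
  zero.\<close>

lemma semiprime_square_nonzero:
  assumes semiprime: "semiprime_algebra" and B: "natural_basis B" and e: "e \<in> B"
  shows "e \<cdot> e \<noteq> 0"
proof
  assume sq: "e \<cdot> e = 0"
  have ideal: "algebra_ideal (span {e})"
    by (rule algebra_ideal_span[OF B]) (use e sq in \<open>auto simp: associated_graph_def representation_zero\<close>)
  have "x \<cdot> y = 0" if "x \<in> span {e}" "y \<in> span {e}" for x y
    using mul_span_eq_0[OF _ that] sq by auto
  with ideal have "ideal_mult (span {e}) (span {e}) = {0}"
    by (simp add: ideal_mult_eq_0_iff)
  with semiprime ideal have "span {e} = {0}"
    by (auto simp: semiprime_algebra_def)
  with span_base[of e "{e}"] have "e = 0" by simp
  with B e show False
    using dependent_zero by (auto simp: natural_basis_def)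
qed

lemma square_in_ideal_of_coordinate_nonzero:
  assumes "natural_basis B" and "algebra_ideal I"
    and "x \<in> I" and "e \<in> B" and nz: "representation B x e \<noteq> 0"
  shows "e \<cdot> e \<in> I"
proof -
  have "x \<cdot> e \<in> I"
    using assms by (simp add: algebra_ideal_def)
  then have "representation B x e *s (e \<cdot> e) \<in> I"
    using assms by (simp add: mul_natural_basis_vector(1)[of B e x])
  then have "inverse (representation B x e) *s (representation B x e *s (e \<cdot> e)) \<in> I"
    using assms(2) unfolding algebra_ideal_def by (blast intro: subspace_scale)
  with nz show ?thesis by simp
qed

lemma square_descendant_in_ideal:
  assumes "natural_basis B" and "algebra_ideal I" and "e \<cdot> e \<in> I"
    and "e \<rightarrow>\<^sup>*\<^bsub>with_proj (associated_graph B)\<^esub> z"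
  shows "z \<cdot> z \<in> I"
  using assms(4) unfolding reachable_def
proof (induction rule: rtrancl_on_induct)
  case base
  then show ?case using assms(3) by simp
next
  case (step y z)
  then show ?case
    using square_in_ideal_of_coordinate_nonzero[OF assms(1,2), of "y \<cdot> y" z]
    by (auto simp: associated_graph_def)
qed

lemma nonzero_ideal_contains_square:
  assumes B: "natural_basis B" and I: "algebra_ideal I" and "I \<noteq> {0}"
  obtains e where "e \<in> B" and "e \<cdot> e \<in> I"
proof -
  have "0 \<in> I"
    using I by (simp add: algebra_ideal_def subspace_0)
  with \<open>I \<noteq> {0}\<close> obtain x where x: "x \<in> I" "x \<noteq> 0" by blast
  have "(\<Sum>v | representation B x v \<noteq> 0. representation B x v *s v) = x"
    using B by (simp add: natural_basis_def sum_nonzero_representation_eq)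
  with x(2) have "{v. representation B x v \<noteq> 0} \<noteq> {}"
    by (metis sum.empty)
  then obtain e where e: "representation B x e \<noteq> 0" by blast
  then have "e \<in> B" by (rule representation_ne_zero)
  with square_in_ideal_of_coordinate_nonzero[OF B I x(1) this e] that show thesis by blast
qed

theorem prime_imp_downward_directed:
  assumes prime: "prime_algebra" and B: "natural_basis B"
  shows "downward_directed (with_proj (associated_graph B))"
  unfolding downward_directed_def
proof (intro ballI)
  let ?G = "with_proj (associated_graph B)"
  let ?D = "\<lambda>u. {z. u \<rightarrow>\<^sup>*\<^bsub>?G\<^esub> z}"
  fix u v assume "u \<in> verts ?G" "v \<in> verts ?G"
  have D_verts: "?D w \<subseteq> B" for w
    by (auto simp: reachable_def associated_graph_def dest: in_rtrancl_on_in_F)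
  have ideal: "algebra_ideal (span (?D w))" for w
  proof (rule algebra_ideal_span[OF B D_verts])
    fix y z assume "y \<in> ?D w" "(y, z) \<in> parcs (associated_graph B)"
    then show "z \<in> ?D w"
      by (auto simp: reachable_def associated_graph_def intro: rtrancl_on_into_rtrancl_on)
  qed
  have nonzero: "span (?D w) \<noteq> {0}" if "w \<in> verts ?G" for w
  proof -
    have "w \<in> span (?D w)"
      using that by (intro span_base) (simp add: reachable_def)
    moreover have "w \<noteq> 0"
      using that B dependent_zero by (auto simp: associated_graph_def natural_basis_def)
    ultimately show ?thesis by blast
  qed
  show "\<exists>z\<in>verts ?G. u \<rightarrow>\<^sup>*\<^bsub>?G\<^esub> z \<and> v \<rightarrow>\<^sup>*\<^bsub>?G\<^esub> z"
  proof (rule ccontr)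
    assume "\<not> ?thesis"
    then have disjoint: "?D u \<inter> ?D v = {}"
      using D_verts by (auto simp: associated_graph_def)
    have orth: "s \<cdot> t = 0" if "s \<in> ?D u" "t \<in> ?D v" for s t
    proof -
      have "s \<in> B" "t \<in> B"
        using that D_verts by blast+
      moreover have "s \<noteq> t"
        using that disjoint by blast
      ultimately show ?thesis
        using B by (simp add: natural_basis_def)
    qed
    have "ideal_mult (span (?D u)) (span (?D v)) = {0}"
      unfolding ideal_mult_eq_0_iff[OF ideal ideal]
      using mul_span_eq_0[of "?D u" "?D v", OF orth] by blast
    with prime ideal have "span (?D u) = {0} \<or> span (?D v) = {0}"
      by (auto simp: prime_algebra_def)
    with nonzero \<open>u \<in> verts ?G\<close> \<open>v \<in> verts ?G\<close> show False by blast
  qed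
qed

theorem semiprime_downward_directed_imp_prime:
  assumes semiprime: "semiprime_algebra" and B: "natural_basis B"
    and directed: "downward_directed (with_proj (associated_graph B))"
  shows "prime_algebra"
  unfolding prime_algebra_def
proof (intro allI impI)
  fix I J assume I: "algebra_ideal I" and J: "algebra_ideal J" and IJ: "ideal_mult I J = {0}"
  show "I = {0} \<or> J = {0}"
  proof (rule ccontr)
    assume "\<not> ?thesis"
    then have "I \<noteq> {0}" "J \<noteq> {0}" by auto
    obtain u where u: "u \<in> B" "u \<cdot> u \<in> I"
      using nonzero_ideal_contains_square[OF B I \<open>I \<noteq> {0}\<close>] .
    obtain v where v: "v \<in> B" "v \<cdot> v \<in> J"
      using nonzero_ideal_contains_square[OF B J \<open>J \<noteq> {0}\<close>] .
    obtain z where "z \<in> B" "u \<rightarrow>\<^sup>*\<^bsub>with_proj (associated_graph B)\<^esub> z"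
      "v \<rightarrow>\<^sup>*\<^bsub>with_proj (associated_graph B)\<^esub> z"
      using directed u(1) v(1) by (auto simp: downward_directed_def associated_graph_def)
    then have z: "z \<cdot> z \<in> I \<inter> J" "z \<cdot> z \<noteq> 0"
      using square_descendant_in_ideal[OF B] I J u(2) v(2) semiprime_square_nonzero[OF semiprime B]
      by auto
    have ideal: "algebra_ideal (I \<inter> J)"
      using I J by (rule algebra_ideal_Int)
    have "ideal_mult (I \<inter> J) (I \<inter> J) = {0}"
      using IJ by (simp add: ideal_mult_eq_0_iff[OF I J] ideal_mult_eq_0_iff[OF ideal ideal])
    with semiprime ideal have "I \<inter> J = {0}"
      by (auto simp: semiprime_algebra_def)
    with z show False by auto
  qed
qed

end

theorem corollary3p15:
  fixes scale :: "'k::field \<Rightarrow> 'a::ab_group_add \<Rightarrow> 'a"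
    and mul :: "'a \<Rightarrow> 'a \<Rightarrow> 'a"
  assumes "evolution_algebra scale mul"
    and "nonassoc_algebra.semiprime_algebra scale mul"
  shows "nonassoc_algebra.prime_algebra scale mul \<longleftrightarrow>
    (\<forall>B. nonassoc_algebra.natural_basis scale mul B \<longrightarrow>
       downward_directed (with_proj (nonassoc_algebra.associated_graph scale mul B)))"
proof -
  interpret evolution_algebra scale mul by (rule assms(1))
  show ?thesis
    using prime_imp_downward_directed semiprime_downward_directed_imp_prime[OF assms(2)]
      ex_natural_basis by blast
qed

end
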